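(* Let $\alpha,\beta\in[0,\pi)$ be distinct. If the quadruple $$\begin{array}{ccc}\mathscr{R}_{\mathsf{H}_\alpha}&\subset&\mathscr{R}\\ \cup&&\cup\\ \mathscr{R}_{\mathsf{H}_\alpha}\cap\mathscr{R}_{\mathsf{H}_\beta}&\subset&\mathscr{R}_{\mathsf{H}_\beta}\end{array}$$ is a commuting square, then $\mathrm{d}_{\mathrm{KK}}(\mathscr{R}_{\mathsf{H}_\alpha},\mathscr{R}_{\mathsf{H}_\beta})=1$.
   Context: Let $n\ge 2$; $\mathbb{M}_n$ is the algebra of $n\times n$ complex matrices with matrix units $E_{ij}$ and identity $\mathbb{I}_n$, and $\Delta\subset \mathbb{M}_n$ is the algebra of diagonal matrices. A Hadamard unitary in $\mathbb{M}_n$ is a unitary matrix all of whose entries have modulus $n^{-1/2}$. Ambient factor: $\mathscr{R}$ is the hyperfinite $\mathrm{II}_1$-factor obtained as the weak closure, in the GNS representation of the unique normalized trace $\tau$, of $\bigcup_k \mathbb{M}_n^{\otimes k}$, where $\mathbb{M}_n^{\otimes k}\subset\mathbb{M}_n^{\otimes(k+1)}$ via $x\mapsto x\otimes \mathbb{I}_n$. Spin model subfactor: for a Hadamard unitary $u=(u_{ij})\in\mathbb{M}_n$ put $D_u:=\sqrt n\sum_{i,j}\overline{u_{ij}}\,(E_{jj}\otimes E_{ii})$, $u_1:=(u\otimes \mathbb{I}_n)D_u\in\mathbb{M}_n\otimes\Delta$, and for $k\ge1$, $u_{2k-1}:=\prod_{i=0}^{k-1}\big(\mathbb{I}_n^{\otimes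 i}\otimes u_1\otimes \mathbb{I}_n^{\otimes (k-1-i)}\big)\in\mathbb{M}_n^{\otimes (k+1)}$ (factors ordered from left to right with increasing $i$). The algebras $u_{2k-1}(\mathbb{M}_n^{\otimes k}\otimes \mathbb{I}_n)u_{2k-1}^*$ increase with $k$, and $\mathscr{R}_u\subset\mathscr{R}$ is the weak closure of their union. For $\alpha\in\mathbb{R}$, $\mathsf{H}_\alpha:=\frac{1}{\sqrt2}\begin{pmatrix}1&1\\ e^{i\alpha}&-e^{i\alpha}\end{pmatrix}$, a $2\times2$ Hadamard unitary; here $n=2$. Commuting square: for von Neumann subalgebras $N\subset P,Q\subset M$ of $(M,\tau)$, with $\tau$-preserving conditional expectations $E_N,E_P,E_Q$, the quadruple is a commuting square if $E_PE_Q=E_N=E_QE_P$. Kadison–Kastler distance: $\mathrm{d}_{\mathrm{KK}}(P,Q)$ is the Hausdorff distance, in operator norm, between the operator-norm closed unit balls of $P$ and $Q$. *)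

theory Defs
  imports
    "HOL-Analysis.Bounded_Linear_Function"
    "Jordan_Normal_Form.Schur_Decomposition"
begin

section \<open>Complex Hilbert spaces and their bounded operators\<close>

text \<open>The inner product is conjugate linear in the first argument.\<close>

class chilbert_space = banach +
  fixes scaleC :: "complex \<Rightarrow> 'a \<Rightarrow> 'a" (infixr \<open>*\<^sub>C\<close> 75)
    and cinner :: "'a \<Rightarrow> 'a \<Rightarrow> complex"
  assumes scaleC_add_right: "c *\<^sub>C (x + y) = c *\<^sub>C x + c *\<^sub>C y"
    and scaleC_add_left: "(c + d) *\<^sub>C x = c *\<^sub>C x + d *\<^sub>C x"
    and scaleC_scaleC: "c *\<^sub>C (d *\<^sub>C x) = (c * d) *\<^sub>C x"
    and scaleC_of_real: "complex_of_real r *\<^sub>C x = r *\<^sub>R x"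
    and cinner_commute: "cinner x y = cnj (cinner y x)"
    and cinner_add_right: "cinner x (y + z) = cinner x y + cinner x z"
    and cinner_scaleC_right: "cinner x (c *\<^sub>C y) = c * cinner x y"
    and cinner_self_ge_zero: "0 \<le> Re (cinner x x)"
    and norm_eq_sqrt_cinner: "norm x = sqrt (Re (cinner x x))"

lemma cinner_scaleC_left:
  "cinner (c *\<^sub>C x) (y :: 'h :: chilbert_space) = cnj c * cinner x y"
  by (metis cinner_commute cinner_scaleC_right complex_cnj_mult)

lemma norm_scaleC: "norm (c *\<^sub>C (x :: 'h :: chilbert_space)) = cmod c * norm x"
proof -
  have "cinner (c *\<^sub>C x) (c *\<^sub>C x) = complex_of_real ((cmod c)\<^sup>2) * cinner x x"
    by (simp only: cinner_scaleC_left cinner_scaleC_right complex_norm_square mult_ac)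
  then have "Re (cinner (c *\<^sub>C x) (c *\<^sub>C x)) = (cmod c)\<^sup>2 * Re (cinner x x)"
    by (simp only: Re_complex_of_real times_complex.simps Im_complex_of_real)
  then show ?thesis
    by (simp add: norm_eq_sqrt_cinner real_sqrt_mult)
qed

lemma bounded_linear_scaleC: "bounded_linear (scaleC c :: 'h :: chilbert_space \<Rightarrow> 'h)"
proof (rule bounded_linear_intro[where K = "cmod c"])
  fix r and x :: 'h
  show "c *\<^sub>C (r *\<^sub>R x) = r *\<^sub>R (c *\<^sub>C x)"
    by (metis scaleC_of_real scaleC_scaleC mult.commute)
qed (simp_all add: scaleC_add_right norm_scaleC mult.commute)

text \<open>
  A bounded operator on a complex Hilbert space is an element of \<open>'h \<Rightarrow>\<^sub>L 'h\<close>
  (bounded and real linear) that is moreover complex linear; its norm as an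
  element of that type is the usual operator norm.
\<close>

definition clinear_op :: "('h :: chilbert_space \<Rightarrow>\<^sub>L 'h) \<Rightarrow> bool"
  where "clinear_op T \<longleftrightarrow> (\<forall>c x. T (c *\<^sub>C x) = c *\<^sub>C T x)"

definition scaleC_op :: "complex \<Rightarrow> ('h :: chilbert_space \<Rightarrow>\<^sub>L 'h) \<Rightarrow> ('h \<Rightarrow>\<^sub>L 'h)"
  where "scaleC_op c T = Blinfun (scaleC c) o\<^sub>L T"

lemma scaleC_op_apply: "blinfun_apply (scaleC_op c T) x = c *\<^sub>C T x"
  by (simp add: scaleC_op_def bounded_linear_Blinfun_apply bounded_linear_scaleC)

definition is_adjoint_op ::
    "('h :: chilbert_space \<Rightarrow>\<^sub>L 'h) \<Rightarrow> ('h \<Rightarrow>\<^sub>L 'h) \<Rightarrow> bool"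
  where "is_adjoint_op S T \<longleftrightarrow> (\<forall>x y. cinner (S x) y = cinner x (T y))"

definition positive_op :: "('h :: chilbert_space \<Rightarrow>\<^sub>L 'h) \<Rightarrow> bool"
  where "positive_op T \<longleftrightarrow> (\<forall>x. 0 \<le> cinner x (T x))"

text \<open>Here \<open>\<le>\<close> is the order on the complex numbers: \<open>0 \<le> z\<close> says that \<open>z\<close> is real and nonnegative.\<close>

text \<open>The codomain \<open>'h \<Rightarrow> 'h \<Rightarrow> complex\<close> carries the topology of pointwise convergence.\<close>

definition weak_operator_topology :: "('h :: chilbert_space \<Rightarrow>\<^sub>L 'h) topology"
  where "weak_operator_topology =
    pullback_topology UNIV (\<lambda>T x y. cinner x (blinfun_apply T y)) euclidean"

definition weak_closure ::
    "('h :: chilbert_space \<Rightarrow>\<^sub>L 'h) set \<Rightarrow> ('h \<Rightarrow>\<^sub>L 'h) set"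
  where "weak_closure S = weak_operator_topology closure_of S"

definition vector_state :: "'h :: chilbert_space \<Rightarrow> ('h \<Rightarrow>\<^sub>L 'h) \<Rightarrow> complex"
  where "vector_state \<Omega> T = cinner \<Omega> (T \<Omega>)"


section \<open>Conditional expectations, commuting squares, Kadison--Kastler distance\<close>

definition cond_expectation ::
    "(('h :: chilbert_space \<Rightarrow>\<^sub>L 'h) \<Rightarrow> complex) \<Rightarrow> ('h \<Rightarrow>\<^sub>L 'h) set \<Rightarrow> ('h \<Rightarrow>\<^sub>L 'h) set
      \<Rightarrow> (('h \<Rightarrow>\<^sub>L 'h) \<Rightarrow> ('h \<Rightarrow>\<^sub>L 'h)) \<Rightarrow> bool"
  where "cond_expectation \<tau> M N E \<longleftrightarrow>
    (\<forall>x\<in>M. E x \<in> N) \<and>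
    (\<forall>x\<in>N. E x = x) \<and>
    (\<forall>x\<in>M. \<forall>y\<in>M. E (x + y) = E x + E y) \<and>
    (\<forall>c. \<forall>x\<in>M. E (scaleC_op c x) = scaleC_op c (E x)) \<and>
    (\<forall>x\<in>M. positive_op x \<longrightarrow> positive_op (E x)) \<and>
    (\<forall>a\<in>N. \<forall>b\<in>N. \<forall>x\<in>M. E (a o\<^sub>L x o\<^sub>L b) = a o\<^sub>L E x o\<^sub>L b) \<and>
    (\<forall>x\<in>M. \<tau> (E x) = \<tau> x)"

text \<open>
  For von Neumann subalgebras of a finite von Neumann algebra with faithful normal
  trace \<open>\<tau>\<close> the \<open>\<tau>\<close>-preserving conditional expectations exist and are unique, so the
  existential quantifier below only gives names to them.
\<close>

definition commuting_square ::
    "(('h :: chilbert_space \<Rightarrow>\<^sub>L 'h) \<Rightarrow> complex) \<Rightarrow> ('h \<Rightarrow>\<^sub>L 'h) set \<Rightarrow> ('h \<Rightarrow>\<^sub>L 'h) set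
      \<Rightarrow> ('h \<Rightarrow>\<^sub>L 'h) set \<Rightarrow> ('h \<Rightarrow>\<^sub>L 'h) set \<Rightarrow> bool"
  where "commuting_square \<tau> M N P Q \<longleftrightarrow>
    N \<subseteq> P \<and> N \<subseteq> Q \<and> P \<subseteq> M \<and> Q \<subseteq> M \<and>
    (\<exists>E\<^sub>N E\<^sub>P E\<^sub>Q.
      cond_expectation \<tau> M N E\<^sub>N \<and> cond_expectation \<tau> M P E\<^sub>P \<and> cond_expectation \<tau> M Q E\<^sub>Q \<and>
      (\<forall>x\<in>M. E\<^sub>P (E\<^sub>Q x) = E\<^sub>N x \<and> E\<^sub>Q (E\<^sub>P x) = E\<^sub>N x))"

text \<open>Meaningful for bounded nonempty sets, as \<open>SUP\<close> is taken in the reals.\<close>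

definition hausdorff_dist :: "'a :: metric_space set \<Rightarrow> 'a set \<Rightarrow> real"
  where "hausdorff_dist A B = max (SUP x\<in>A. infdist x B) (SUP y\<in>B. infdist y A)"

definition kadison_kastler_dist ::
    "('h :: chilbert_space \<Rightarrow>\<^sub>L 'h) set \<Rightarrow> ('h \<Rightarrow>\<^sub>L 'h) set \<Rightarrow> real"
  where "kadison_kastler_dist P Q = hausdorff_dist (P \<inter> cball 0 1) (Q \<inter> cball 0 1)"


section \<open>The hyperfinite factor\<close>

text \<open>
  The \<open>k\<close>-fold tensor power of the \<open>n \<times> n\<close> matrices is realised as the
  \<open>n ^ k \<times> n ^ k\<close> matrices, tensors being Kronecker products: in \<open>kron A B\<close> the
  index of \<open>A\<close> is the more significant one.
\<close>

definition kron :: "complex mat \<Rightarrow> complex mat \<Rightarrow> complex mat"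
  where "kron A B = mat (dim_row A * dim_row B) (dim_col A * dim_col B)
    (\<lambda>(i, j). A $$ (i div dim_row B, j div dim_col B) * B $$ (i mod dim_row B, j mod dim_col B))"

abbreviation tensor_power_mats :: "nat \<Rightarrow> nat \<Rightarrow> complex mat set"
  where "tensor_power_mats n k \<equiv> carrier_mat (n ^ k) (n ^ k)"

text \<open>
  \<open>(\<pi>, \<Omega>)\<close> is a GNS representation, on the Hilbert space \<open>'h\<close>, of the increasing union of
  the tensor powers with respect to its normalised trace.  A representation of the
  union is a family of representations of the tensor powers compatible with the
  embeddings that send \<open>x\<close> to \<open>x \<otimes> I\<close>; as \<open>n \<ge> 2\<close>, the size of a matrix determines the
  tensor power it belongs to, and the family is given by the single function \<open>\<pi>\<close>.
  Such a triple is unique up to unitary equivalence.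
\<close>

locale gns_representation =
  fixes n :: nat
    and \<pi> :: "complex mat \<Rightarrow> ('h :: chilbert_space \<Rightarrow>\<^sub>L 'h)"
    and \<Omega> :: 'h
  assumes n_ge_2: "n \<ge> 2"
    and clinear: "x \<in> tensor_power_mats n k \<Longrightarrow> clinear_op (\<pi> x)"
    and add: "x \<in> tensor_power_mats n k \<Longrightarrow> y \<in> tensor_power_mats n k \<Longrightarrow> \<pi> (x + y) = \<pi> x + \<pi> y"
    and smult: "x \<in> tensor_power_mats n k \<Longrightarrow> \<pi> (c \<cdot>\<^sub>m x) = scaleC_op c (\<pi> x)"
    and mult: "x \<in> tensor_power_mats n k \<Longrightarrow> y \<in> tensor_power_mats n k \<Longrightarrow> \<pi> (x * y) = \<pi> x o\<^sub>L \<pi> y"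
    and one: "\<pi> (1\<^sub>m (n ^ k)) = id_blinfun"
    and adjoint: "x \<in> tensor_power_mats n k \<Longrightarrow> is_adjoint_op (\<pi> (mat_adjoint x)) (\<pi> x)"
    and embedding: "x \<in> tensor_power_mats n k \<Longrightarrow> \<pi> (kron x (1\<^sub>m n)) = \<pi> x"
    and trace: "x \<in> tensor_power_mats n k \<Longrightarrow>
      vector_state \<Omega> (\<pi> x) = (\<Sum>i<n ^ k. x $$ (i, i)) / of_nat (n ^ k)"
    and cyclic: "closure {\<pi> x \<Omega> | x k. x \<in> tensor_power_mats n k} = UNIV"

definition hyperfinite_factor ::
    "nat \<Rightarrow> (complex mat \<Rightarrow> ('h :: chilbert_space \<Rightarrow>\<^sub>L 'h)) \<Rightarrow> ('h \<Rightarrow>\<^sub>L 'h) set"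
  where "hyperfinite_factor n \<pi> = weak_closure (\<Union>k. \<pi> ` tensor_power_mats n k)"


section \<open>Spin model subfactors\<close>

definition unit_mat :: "nat \<Rightarrow> nat \<Rightarrow> nat \<Rightarrow> complex mat"
  where "unit_mat n i j = mat n n (\<lambda>(r, s). if r = i \<and> s = j then 1 else 0)"

text \<open>The sum of matrices defining \<open>D\<^sub>u\<close> is written entrywise.\<close>

definition spin_D :: "nat \<Rightarrow> complex mat \<Rightarrow> complex mat"
  where "spin_D n u = complex_of_real (sqrt (real n)) \<cdot>\<^sub>m mat (n * n) (n * n)
    (\<lambda>rs. \<Sum>i<n. \<Sum>j<n. cnj (u $$ (i, j)) * kron (unit_mat n j j) (unit_mat n i i) $$ rs)"

definition spin_u1 :: "nat \<Rightarrow> complex mat \<Rightarrow> complex mat"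
  where "spin_u1 n u = kron u (1\<^sub>m n) * spin_D n u"

text \<open>\<open>spin_unitary n u k\<close> is the element \<open>u\<^bsub>2k-1\<^esub>\<close> of the \<open>(k + 1)\<close>-st tensor power.\<close>

definition spin_unitary :: "nat \<Rightarrow> complex mat \<Rightarrow> nat \<Rightarrow> complex mat"
  where "spin_unitary n u k =
    foldr (\<lambda>i A. kron (kron (1\<^sub>m (n ^ i)) (spin_u1 n u)) (1\<^sub>m (n ^ (k - 1 - i))) * A)
      [0..<k] (1\<^sub>m (n ^ (k + 1)))"

definition spin_algebra :: "nat \<Rightarrow> complex mat \<Rightarrow> nat \<Rightarrow> complex mat set"
  where "spin_algebra n u k =
    {spin_unitary n u k * kron x (1\<^sub>m n) * mat_adjoint (spin_unitary n u k) | x.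
      x \<in> tensor_power_mats n k}"

definition spin_subfactor ::
    "nat \<Rightarrow> (complex mat \<Rightarrow> ('h :: chilbert_space \<Rightarrow>\<^sub>L 'h)) \<Rightarrow> complex mat \<Rightarrow> ('h \<Rightarrow>\<^sub>L 'h) set"
  where "spin_subfactor n \<pi> u = weak_closure (\<Union>k\<in>{1..}. \<pi> ` spin_algebra n u k)"

definition hadamard2 :: "real \<Rightarrow> complex mat"
  where "hadamard2 \<alpha> = complex_of_real (1 / sqrt 2) \<cdot>\<^sub>m
    mat_of_rows_list 2 [[1, 1], [exp (\<i> * complex_of_real \<alpha>), - exp (\<i> * complex_of_real \<alpha>)]]"

end

theory Submission
  imports Defs
begin

text \<open>
  Write \<open>P\<close> and \<open>Q\<close> for the subfactors of the parameters \<open>\<alpha>\<close> and \<open>\<beta>\<close>, let \<open>N = P \<inter> Q\<close>, and let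
  \<open>s\<^sub>\<alpha>\<close> be the self-adjoint unitary matrix with off-diagonal entries \<open>cis (- \<alpha>)\<close> and \<open>cis \<alpha>\<close>.
  The distance is at most 1 because 0 lies in both unit balls.  The lower bound comes from a
  single element: \<open>s\<^sub>\<alpha>\<close>, placed in the first tensor factor, is a unitary of \<open>P\<close> that is orthogonal
  to all of \<open>Q\<close> for the inner product of the trace.  Then, for every \<open>y\<close> in \<open>Q\<close>, Pythagoras gives
  \<open>\<parallel>s\<^sub>\<alpha> - y\<parallel>\<^sup>2 \<ge> \<parallel>(s\<^sub>\<alpha> - y) \<Omega>\<parallel>\<^sup>2 = 1 + \<parallel>y \<Omega>\<parallel>\<^sup>2\<close>; this is \<open>kadison_kastler_dist_eq_1\<close>.

  A commuting square reduces orthogonality to \<open>Q\<close> to orthogonality to \<open>N\<close>: the expectation of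
  \<open>s\<^sub>\<alpha>\<close> on \<open>Q\<close> is its expectation on \<open>N\<close>, which is zero if \<open>s\<^sub>\<alpha>\<close> is orthogonal to \<open>N\<close>
  (\<open>commuting_square_orthogonal\<close>).

  Orthogonality to \<open>N\<close> rests on the shape of \<open>P\<close>.  With the Pauli matrices \<open>X\<close> and
  \<open>Z = diag (1, -1)\<close>, the algebra \<open>P\<close> is generated by \<open>s\<^sub>\<alpha>\<close> in the first factor, by \<open>X\<close> in each later
  factor, and by \<open>Z \<otimes> Z\<close> in each pair of neighbouring factors; it is the fixed point algebra of the
  automorphism that conjugates the first factor by \<open>s\<^sub>\<alpha>\<close> and all others by \<open>X\<close>.  This automorphism
  negates the matrix \<open>Z s\<^sub>\<alpha>\<close> of the first factor, so that \<open>Z s\<^sub>\<alpha>\<close> is orthogonal to \<open>P\<close>.  What is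
  proved is just this orthogonality: conjugation by the unitaries \<open>u\<^bsub>2k-1\<^esub>\<close> carries
  \<open>Z s\<^sub>\<alpha>\<close> to a tensor whose last factor is the traceless matrix \<open>Z\<close>, while it carries the elements of
  \<open>P\<close> at level \<open>k\<close> to matrices with the identity in the last factor (\<open>spin_algebra_trace_zero\<close>).
  Likewise \<open>Z s\<^sub>\<beta>\<close> is orthogonal to \<open>Q\<close>.  Hence both are orthogonal to \<open>N\<close>, and if \<open>\<alpha>\<close> and \<open>\<beta>\<close>
  differ modulo \<open>\<pi>\<close> they span all matrices with zero diagonal, \<open>s\<^sub>\<alpha>\<close> among them
  (\<open>reflection_in_span\<close>).
\<close>


section \<open>Kronecker products\<close>

lemma dim_kron [simp]:
  "dim_row (kron A B) = dim_row A * dim_row B"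
  "dim_col (kron A B) = dim_col A * dim_col B"
  by (simp_all add: kron_def)

lemma kron_carrier:
  "A \<in> carrier_mat a b \<Longrightarrow> B \<in> carrier_mat c d \<Longrightarrow> kron A B \<in> carrier_mat (a * c) (b * d)"
  by auto

lemma index_kron:
  "i < dim_row A * dim_row B \<Longrightarrow> j < dim_col A * dim_col B \<Longrightarrow>
    kron A B $$ (i, j) = A $$ (i div dim_row B, j div dim_col B) * B $$ (i mod dim_row B, j mod dim_col B)"
  by (simp add: kron_def)

lemma mod_less_of_less_mult: "i < a * c \<Longrightarrow> i mod c < (c :: nat)"
  by (metis mod_less_divisor mult_0_right not_less_zero gr0I)

lemma sum_div_mod:
  fixes f :: "nat \<Rightarrow> nat \<Rightarrow> 'a :: comm_monoid_add"
  shows "(\<Sum>m<a * b. f (m div b) (m mod b)) = (\<Sum>i<a. \<Sum>j<b. f i j)"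
proof -
  have "(\<Sum>i<a. \<Sum>j<b. f i j) = (\<Sum>i<a. \<Sum>m\<in>{i * b..<i * b + b}. f (m div b) (m mod b))"
  proof (rule sum.cong[OF refl])
    fix i
    have "(\<Sum>m\<in>{0 + i * b..<b + i * b}. f (m div b) (m mod b))
      = (\<Sum>j\<in>{0..<b}. f ((j + i * b) div b) ((j + i * b) mod b))"
      by (rule sum.shift_bounds_nat_ivl)
    then show "(\<Sum>j<b. f i j) = (\<Sum>m\<in>{i * b..<i * b + b}. f (m div b) (m mod b))"
      by (simp add: add.commute atLeast0LessThan)
  qed
  then show ?thesis
    by (simp add: sum.nat_group)
qed

lemma kron_mult:
  assumes "dim_col A = dim_row C" and "dim_col B = dim_row D"
  shows "kron A B * kron C D = kron (A * C) (B * D)"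
proof (rule eq_matI)
  fix i j
  assume "i < dim_row (kron (A * C) (B * D))" and "j < dim_col (kron (A * C) (B * D))"
  then have i: "i < dim_row A * dim_row B" and j: "j < dim_col C * dim_col D"
    by simp_all
  note less = less_mult_imp_div_less[OF i] less_mult_imp_div_less[OF j]
    mod_less_of_less_mult[OF i] mod_less_of_less_mult[OF j]
  have "(kron A B * kron C D) $$ (i, j) = (\<Sum>m<dim_row C * dim_row D.
      (A $$ (i div dim_row B, m div dim_row D) * C $$ (m div dim_row D, j div dim_col D)) *
      (B $$ (i mod dim_row B, m mod dim_row D) * D $$ (m mod dim_row D, j mod dim_col D)))"
    using i j assms by (simp add: scalar_prod_def index_kron atLeast0LessThan mult_ac)
  also have "\<dots> = (\<Sum>p<dim_row C. \<Sum>q<dim_row D.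
      (A $$ (i div dim_row B, p) * C $$ (p, j div dim_col D)) *
      (B $$ (i mod dim_row B, q) * D $$ (q, j mod dim_col D)))"
    by (rule sum_div_mod)
  also have "\<dots> = kron (A * C) (B * D) $$ (i, j)"
    using i j less assms
    by (simp add: index_kron scalar_prod_def atLeast0LessThan sum_product)
  finally show "(kron A B * kron C D) $$ (i, j) = kron (A * C) (B * D) $$ (i, j)" .
qed simp_all

lemma kron_assoc: "kron (kron A B) C = kron A (kron B C)"
proof (rule eq_matI)
  fix i j
  assume "i < dim_row (kron A (kron B C))" and "j < dim_col (kron A (kron B C))"
  then have i: "i < dim_row A * dim_row B * dim_row C" and j: "j < dim_col A * dim_col B * dim_col C"
    by (simp_all add: mult.assoc)
  have i': "i < dim_row A * (dim_row B * dim_row C)" and j': "j < dim_col A * (dim_col B * dim_col C)"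
    using i j by (simp_all add: mult.assoc)
  note less = less_mult_imp_div_less[OF i] less_mult_imp_div_less[OF j]
    mod_less_of_less_mult[OF i'] mod_less_of_less_mult[OF j']
  have [simp]: "m mod (b * c) div c = m div c mod b" "m mod (b * c) mod c = m mod c"
    if "m < a * b * c" for a b c m :: nat
  proof -
    from that have "0 < c" by (metis gr0I mult_0_right not_less_zero)
    then show "m mod (b * c) div c = m div c mod b" "m mod (b * c) mod c = m mod c"
      using mod_mult2_eq[of m c b] by (simp_all add: mult.commute)
  qed
  show "kron (kron A B) C $$ (i, j) = kron A (kron B C) $$ (i, j)"
    using i j i' j' less
    by (simp add: index_kron div_mult2_eq[symmetric] mult_ac)
qed (simp_all add: mult.assoc)

lemma kron_one: "kron (1\<^sub>m a) (1\<^sub>m b) = 1\<^sub>m (a * b)"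
proof (rule eq_matI)
  fix i j
  assume "i < dim_row (1\<^sub>m (a * b) :: complex mat)" and "j < dim_col (1\<^sub>m (a * b) :: complex mat)"
  then have i: "i < a * b" and j: "j < a * b"
    by simp_all
  have "i = j \<longleftrightarrow> i div b = j div b \<and> i mod b = j mod b"
    by (metis div_mult_mod_eq)
  then show "kron (1\<^sub>m a) (1\<^sub>m b) $$ (i, j) = 1\<^sub>m (a * b) $$ (i, j)"
    using i j less_mult_imp_div_less[OF i] less_mult_imp_div_less[OF j]
      mod_less_of_less_mult[OF i] mod_less_of_less_mult[OF j]
    by (simp add: index_kron)
qed simp_all

lemma dim_mat_adjoint [simp]:
  "dim_row (mat_adjoint A) = dim_col A" "dim_col (mat_adjoint A) = dim_row A"
  by (simp_all add: mat_adjoint_def)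

lemma index_mat_adjoint [simp]:
  "i < dim_col A \<Longrightarrow> j < dim_row A \<Longrightarrow> mat_adjoint A $$ (i, j) = cnj (A $$ (j, i))"
  by (simp add: mat_adjoint_def mat_of_rows_def)

lemma mat_adjoint_carrier: "A \<in> carrier_mat a b \<Longrightarrow> mat_adjoint A \<in> carrier_mat b a"
  by auto

lemma mat_adjoint_adjoint: "mat_adjoint (mat_adjoint A) = (A :: complex mat)"
  by (rule eq_matI) simp_all

lemma mat_adjoint_mult:
  "dim_col A = dim_row B \<Longrightarrow> mat_adjoint (A * B) = mat_adjoint B * (mat_adjoint A :: complex mat)"
  by (rule eq_matI) (simp_all add: scalar_prod_def mult.commute)

lemma mat_adjoint_one: "mat_adjoint (1\<^sub>m d :: complex mat) = 1\<^sub>m d"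
  by (rule eq_matI) auto

lemma mat_adjoint_kron: "mat_adjoint (kron A B) = kron (mat_adjoint A) (mat_adjoint B)"
  by (rule eq_matI) (simp_all add: index_kron less_mult_imp_div_less mod_less_of_less_mult)

definition mat_trace :: "complex mat \<Rightarrow> complex"
  where "mat_trace A = (\<Sum>i<dim_row A. A $$ (i, i))"

lemma mat_trace_commute:
  assumes "A \<in> carrier_mat d d" and "B \<in> carrier_mat d d"
  shows "mat_trace (A * B) = mat_trace (B * A)"
proof -
  have "mat_trace (A * B) = (\<Sum>i<d. \<Sum>j<d. A $$ (i, j) * B $$ (j, i))"
    using assms by (simp add: mat_trace_def scalar_prod_def atLeast0LessThan)
  also have "\<dots> = (\<Sum>j<d. \<Sum>i<d. A $$ (i, j) * B $$ (j, i))"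
    by (rule sum.swap)
  also have "\<dots> = mat_trace (B * A)"
    using assms by (simp add: mat_trace_def scalar_prod_def atLeast0LessThan mult.commute)
  finally show ?thesis .
qed

lemma mat_trace_kron:
  assumes "A \<in> carrier_mat a a" and "B \<in> carrier_mat b b"
  shows "mat_trace (kron A B) = mat_trace A * mat_trace B"
proof -
  have "mat_trace (kron A B) = (\<Sum>m<a * b. A $$ (m div b, m div b) * B $$ (m mod b, m mod b))"
    using assms by (simp add: mat_trace_def index_kron)
  also have "\<dots> = (\<Sum>i<a. \<Sum>j<b. A $$ (i, i) * B $$ (j, j))"
    by (rule sum_div_mod)
  also have "\<dots> = mat_trace A * mat_trace B"
    using assms by (simp add: mat_trace_def sum_product)
  finally show ?thesis .
qed


section \<open>The unitaries of a spin model\<close>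

lemma spin_u1_carrier: "u \<in> carrier_mat n n \<Longrightarrow> spin_u1 n u \<in> carrier_mat (n * n) (n * n)"
  unfolding spin_u1_def by (auto simp: spin_D_def)

lemma spin_factor_carrier:
  assumes "u \<in> carrier_mat n n" and "i < k"
  shows "kron (kron (1\<^sub>m (n ^ i)) (spin_u1 n u)) (1\<^sub>m (n ^ (k - 1 - i))) \<in> tensor_power_mats n (k + 1)"
proof -
  obtain d where k: "k = Suc (i + d)"
    using assms(2) less_imp_Suc_add by auto
  show ?thesis
    using spin_u1_carrier[OF assms(1)] by (auto simp: k power_add mult_ac)
qed

lemma spin_unitary_foldr_carrier:
  assumes "u \<in> carrier_mat n n" and "set xs \<subseteq> {..<k}"
  shows "foldr (\<lambda>i A. kron (kron (1\<^sub>m (n ^ i)) (spin_u1 n u)) (1\<^sub>m (n ^ (k - 1 - i))) * A)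
      xs (1\<^sub>m (n ^ (k + 1))) \<in> tensor_power_mats n (k + 1)"
  using assms(2)
  by (induction xs)
    (auto simp del: power_Suc dim_kron intro!: mult_carrier_mat spin_factor_carrier[OF assms(1), simplified])

lemma spin_unitary_carrier:
  "u \<in> carrier_mat n n \<Longrightarrow> spin_unitary n u k \<in> tensor_power_mats n (k + 1)"
  unfolding spin_unitary_def by (rule spin_unitary_foldr_carrier) auto

text \<open>
  Splitting off the first factor of the product, rather than the last, exposes the other factors as
  \<open>u\<^bsub>2k-1\<^esub>\<close> shifted by one place.  This is the recursion for inductions in which a matrix
  of the first tensor factor is moved to the right.
\<close>

lemma spin_unitary_Suc:
  assumes u: "u \<in> carrier_mat n n"
  shows "spin_unitary n u (Suc k) =
    kron (spin_u1 n u) (1\<^sub>m (n ^ k)) * kron (1\<^sub>m n) (spin_unitary n u k)"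
proof -
  let ?W = "\<lambda>k i. kron (kron (1\<^sub>m (n ^ i)) (spin_u1 n u)) (1\<^sub>m (n ^ (k - 1 - i)))"
  let ?F = "\<lambda>k xs. foldr (\<lambda>i A. ?W k i * A) xs (1\<^sub>m (n ^ (k + 1)))"
  have shift: "?F (Suc k) (map Suc xs) = kron (1\<^sub>m n) (?F k xs)" if "set xs \<subseteq> {..<k}" for xs
    using that
  proof (induction xs)
    case Nil
    show ?case by (simp add: kron_one)
  next
    case (Cons i xs)
    have "?W (Suc k) (Suc i) = kron (1\<^sub>m n) (?W k i)"
      by (simp add: kron_assoc[symmetric] kron_one)
    moreover have "kron (1\<^sub>m n) (?W k i) * kron (1\<^sub>m n) (?F k xs) = kron (1\<^sub>m n * 1\<^sub>m n) (?W k i * ?F k xs)"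
      using spin_factor_carrier[OF u, of i k] spin_unitary_foldr_carrier[OF u, of xs k] Cons.prems
      by (intro kron_mult) auto
    ultimately show ?case
      using Cons by simp
  qed
  have "kron (1\<^sub>m (n ^ 0)) (spin_u1 n u) = spin_u1 n u"
    by (rule eq_matI) (auto simp: index_kron)
  moreover have "[0..<Suc k] = 0 # map Suc [0..<k]"
    by (simp add: upt_conv_Cons map_Suc_upt del: upt_Suc)
  ultimately show ?thesis
    using shift[of "[0..<k]"] by (simp add: spin_unitary_def atLeast0LessThan)
qed


lemma spin_unitary_isometry:
  assumes u: "u \<in> carrier_mat n n"
    and isometry: "mat_adjoint (spin_u1 n u) * spin_u1 n u = 1\<^sub>m (n * n)"
  shows "mat_adjoint (spin_unitary n u k) * spin_unitary n u k = 1\<^sub>m (n ^ (k + 1))"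
proof (induction k)
  case 0
  show ?case by (simp add: spin_unitary_def mat_adjoint_one)
next
  case (Suc k)
  let ?A = "kron (spin_u1 n u) (1\<^sub>m (n ^ k))" and ?B = "kron (1\<^sub>m n) (spin_unitary n u k)"
  have v: "spin_u1 n u \<in> carrier_mat (n * n) (n * n)"
    by (rule spin_u1_carrier[OF u])
  have U: "spin_unitary n u k \<in> tensor_power_mats n (k + 1)"
    by (rule spin_unitary_carrier[OF u])
  have A: "?A \<in> tensor_power_mats n (Suc k + 1)" and B: "?B \<in> tensor_power_mats n (Suc k + 1)"
    using v U by (auto simp: mult_ac)
  have A1: "mat_adjoint ?A * ?A = 1\<^sub>m (n ^ (Suc k + 1))"
    using v isometry by (simp add: mat_adjoint_kron mat_adjoint_one kron_mult kron_one mult.assoc)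
  have B1: "mat_adjoint ?B * ?B = 1\<^sub>m (n ^ (Suc k + 1))"
    using U Suc by (simp add: mat_adjoint_kron mat_adjoint_one kron_mult kron_one)
  have "mat_adjoint (?A * ?B) * (?A * ?B) = mat_adjoint ?B * mat_adjoint ?A * (?A * ?B)"
    using v U by (subst mat_adjoint_mult) (auto simp: mult_ac)
  also have "\<dots> = mat_adjoint ?B * ((mat_adjoint ?A * ?A) * ?B)"
    using A B mat_adjoint_carrier[OF A] mat_adjoint_carrier[OF B]
    by (smt (verit) assoc_mult_mat mult_carrier_mat)
  also have "\<dots> = 1\<^sub>m (n ^ (Suc k + 1))"
    unfolding A1 left_mult_one_mat[OF B] by (rule B1)
  finally show ?case
    by (simp only: spin_unitary_Suc[OF u])
qed

text \<open>
  Passing \<open>x \<otimes> I \<otimes> \<dots> \<otimes> I\<close> through the first \<open>u\<^sub>1\<close> leaves \<open>c\<close> in the first place, where the remaining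
  factors act trivially, and a new matrix \<open>z\<close> in the second place, to which the shifted
  \<open>u\<^bsub>2k-1\<^esub>\<close> applies.
\<close>

lemma spin_unitary_Suc_intertwines:
  assumes u: "u \<in> carrier_mat n n" and x: "x \<in> carrier_mat n n"
    and c: "c \<in> carrier_mat n n" and z: "z \<in> carrier_mat n n"
    and B: "B \<in> tensor_power_mats n k"
    and first: "kron x (1\<^sub>m n) * spin_u1 n u = spin_u1 n u * kron c z"
    and rest: "kron z (1\<^sub>m (n ^ k)) * spin_unitary n u k = spin_unitary n u k * kron B z"
  shows "kron x (1\<^sub>m (n ^ Suc k)) * spin_unitary n u (Suc k) =
    spin_unitary n u (Suc k) * kron (kron c B) z"
proof -
  let ?I = "1\<^sub>m (n ^ k)" and ?v = "spin_u1 n u" and ?U = "spin_unitary n u k"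
  let ?T = "tensor_power_mats n (k + 2)"
  have v: "?v \<in> carrier_mat (n * n) (n * n)" and U: "?U \<in> tensor_power_mats n (k + 1)"
    using spin_u1_carrier[OF u] spin_unitary_carrier[OF u] by auto
  have carrier: "kron x (1\<^sub>m (n ^ Suc k)) \<in> ?T" "kron ?v ?I \<in> ?T" "kron (1\<^sub>m n) ?U \<in> ?T"
      "kron c (kron z ?I) \<in> ?T" "kron (kron c B) z \<in> ?T"
    using x v U c z B by (auto simp: mult_ac)
  have "kron x (1\<^sub>m (n ^ Suc k)) * kron ?v ?I = kron (kron x (1\<^sub>m n) * ?v) (?I * ?I)"
    using x v by (subst kron_mult[symmetric]) (auto simp: kron_assoc kron_one)
  also have "\<dots> = kron ?v ?I * kron c (kron z ?I)"
    unfolding first kron_assoc[symmetric] using v c z by (subst kron_mult) auto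
  finally have 1: "kron x (1\<^sub>m (n ^ Suc k)) * kron ?v ?I = kron ?v ?I * kron c (kron z ?I)" .
  have "kron c (kron z ?I) * kron (1\<^sub>m n) ?U = kron c (?U * kron B z)"
    using c z U rest by (subst kron_mult) auto
  also have "\<dots> = kron (1\<^sub>m n) ?U * kron c (kron B z)"
    using c z U B by (subst kron_mult) auto
  finally have 2: "kron c (kron z ?I) * kron (1\<^sub>m n) ?U = kron (1\<^sub>m n) ?U * kron (kron c B) z"
    by (simp only: kron_assoc)
  show ?thesis
    unfolding spin_unitary_Suc[OF u]
    by (smt (verit) 1 2 carrier assoc_mult_mat)
qed

text \<open>
  If \<open>u\<^sub>1\<close> reproduces \<open>z\<close> one place further to the right, then after all factors \<open>z\<close> has arrived in the
  last place.  It leaves some \<open>B\<close> behind in the other places, which enters a trace only as a factor next to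
  the trace of \<open>z\<close>.
\<close>

lemma spin_unitary_intertwines:
  assumes u: "u \<in> carrier_mat n n"
    and c: "c \<in> carrier_mat n n" and z: "z \<in> carrier_mat n n"
    and intertwines: "kron z (1\<^sub>m n) * spin_u1 n u = spin_u1 n u * kron c z"
  shows "\<exists>B\<in>tensor_power_mats n k.
    kron z (1\<^sub>m (n ^ k)) * spin_unitary n u k = spin_unitary n u k * kron B z"
proof (induction k)
  case 0
  have "kron z (1\<^sub>m 1) = kron (1\<^sub>m 1) z"
    by (rule eq_matI) (auto simp: index_kron)
  then show ?case
    using z by (intro bexI[of _ "1\<^sub>m 1"]) (auto simp: spin_unitary_def)
next
  case (Suc k)
  then obtain B where "B \<in> tensor_power_mats n k"
    and "kron z (1\<^sub>m (n ^ k)) * spin_unitary n u k = spin_unitary n u k * kron B z"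
    by blast
  then show ?case
    using spin_unitary_Suc_intertwines[OF u z c z _ intertwines] kron_carrier[OF c]
    by (intro bexI[of _ "kron c B"]) auto
qed

lemma spin_algebra_carrier:
  assumes "u \<in> carrier_mat n n" and "y \<in> spin_algebra n u k"
  shows "y \<in> tensor_power_mats n (k + 1)"
  using assms(2) spin_unitary_carrier[OF assms(1), of k]
  by (auto simp: spin_algebra_def mult.commute)

lemma mat_adjoint_spin_algebra:
  assumes u: "u \<in> carrier_mat n n" and "y \<in> spin_algebra n u k"
  shows "mat_adjoint y \<in> spin_algebra n u k"
proof -
  let ?U = "spin_unitary n u k"
  obtain x where x: "x \<in> tensor_power_mats n k" and y: "y = ?U * kron x (1\<^sub>m n) * mat_adjoint ?U"
    using assms(2) by (auto simp: spin_algebra_def)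
  have U: "?U \<in> tensor_power_mats n (k + 1)"
    by (rule spin_unitary_carrier[OF u])
  have K: "kron x (1\<^sub>m n) \<in> tensor_power_mats n (k + 1)"
    using x by (auto simp: mult.commute)
  have "mat_adjoint y = ?U * (mat_adjoint (kron x (1\<^sub>m n)) * mat_adjoint ?U)"
    unfolding y using carrier_matD[OF U] carrier_matD[OF x]
    by (simp add: mat_adjoint_mult mat_adjoint_adjoint mult.commute)
  also have "\<dots> = ?U * mat_adjoint (kron x (1\<^sub>m n)) * mat_adjoint ?U"
    by (rule assoc_mult_mat[OF U mat_adjoint_carrier[OF K] mat_adjoint_carrier[OF U], symmetric])
  also have "mat_adjoint (kron x (1\<^sub>m n)) = kron (mat_adjoint x) (1\<^sub>m n)"
    by (simp add: mat_adjoint_kron mat_adjoint_one)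
  finally show ?thesis
    using mat_adjoint_carrier[OF x] by (auto simp: spin_algebra_def)
qed

text \<open>
  The trace is that of the product of the two matrices conjugated by \<open>u\<^bsub>2k-1\<^esub>\<close>.  There \<open>x\<close> has
  become a tensor with last factor \<open>z\<close>, and \<open>y\<close> has last factor \<open>I\<close>, so \<open>z\<close> contributes
  its trace as a factor.
\<close>

lemma spin_algebra_trace_zero:
  assumes u: "u \<in> carrier_mat n n" and x: "x \<in> carrier_mat n n"
    and c: "c \<in> carrier_mat n n" "d \<in> carrier_mat n n" and z: "z \<in> carrier_mat n n"
    and isometry: "mat_adjoint (spin_u1 n u) * spin_u1 n u = 1\<^sub>m (n * n)"
    and x_intertwines: "kron x (1\<^sub>m n) * spin_u1 n u = spin_u1 n u * kron c z"
    and z_intertwines: "kron z (1\<^sub>m n) * spin_u1 n u = spin_u1 n u * kron d z"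
    and z_trace: "mat_trace z = 0"
    and y: "y \<in> spin_algebra n u (Suc k)"
  shows "mat_trace (kron x (1\<^sub>m (n ^ Suc k)) * y) = 0"
proof -
  let ?U = "spin_unitary n u (Suc k)" and ?X = "kron x (1\<^sub>m (n ^ Suc k))"
  let ?d = "n ^ (Suc k + 1)"
  obtain a where a: "a \<in> tensor_power_mats n (Suc k)"
    and y: "y = ?U * kron a (1\<^sub>m n) * mat_adjoint ?U"
    using y by (auto simp: spin_algebra_def)
  obtain B where B: "B \<in> tensor_power_mats n k"
    and "kron z (1\<^sub>m (n ^ k)) * spin_unitary n u k = spin_unitary n u k * kron B z"
    using spin_unitary_intertwines[OF u c(2) z z_intertwines] by blast
  then have XU: "?X * ?U = ?U * kron (kron c B) z"
    using spin_unitary_Suc_intertwines[OF u x c(1) z _ x_intertwines] by blast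
  have cB: "kron c B \<in> tensor_power_mats n (Suc k)"
    using kron_carrier[OF c(1) B] by simp
  have U: "?U \<in> carrier_mat ?d ?d"
    by (rule spin_unitary_carrier[OF u])
  have U': "mat_adjoint ?U \<in> carrier_mat ?d ?d"
    by (rule mat_adjoint_carrier[OF U])
  have X: "?X \<in> carrier_mat ?d ?d" and K: "kron a (1\<^sub>m n) \<in> carrier_mat ?d ?d"
    using x a by (auto simp: mult_ac)
  have C: "kron (kron c B) z \<in> carrier_mat ?d ?d"
    using kron_carrier[OF cB z] by (simp add: mult_ac)
  have "?X * y = (?X * ?U) * (kron a (1\<^sub>m n) * mat_adjoint ?U)"
    unfolding y using U U' X K by (smt (verit) assoc_mult_mat mult_carrier_mat)
  also have "\<dots> = ?U * (kron (kron c B) z * kron a (1\<^sub>m n) * mat_adjoint ?U)"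
    unfolding XU using U U' C K by (smt (verit) assoc_mult_mat mult_carrier_mat)
  finally have Xy: "?X * y = ?U * (kron (kron c B) z * kron a (1\<^sub>m n) * mat_adjoint ?U)" .
  have CK: "kron (kron c B) z * kron a (1\<^sub>m n) \<in> carrier_mat ?d ?d"
    by (rule mult_carrier_mat[OF C K])
  have "mat_trace (?X * y) = mat_trace (kron (kron c B) z * kron a (1\<^sub>m n) * mat_adjoint ?U * ?U)"
    unfolding Xy by (rule mat_trace_commute[OF U mult_carrier_mat[OF CK U']])
  also have "\<dots> = mat_trace (kron (kron c B) z * kron a (1\<^sub>m n))"
    unfolding assoc_mult_mat[OF CK U' U] spin_unitary_isometry[OF u isometry] right_mult_one_mat[OF CK] ..
  also have "\<dots> = mat_trace (kron (kron c B * a) z)"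
    using cB a z by (subst kron_mult) auto
  also have "\<dots> = 0"
    using mat_trace_kron[OF mult_carrier_mat[OF cB a] z] z_trace by simp
  finally show ?thesis .
qed

text \<open>
  At the first level \<open>u\<^bsub>2k-1\<^esub>\<close> is \<open>u\<^sub>1\<close>, and an intertwining relation is membership.  Scalars \<open>s = z\<close>
  commute with \<open>u\<^sub>1\<close>, so the criterion also covers zero and the identity.
\<close>

lemma spin_algebra_oneI:
  assumes u: "u \<in> carrier_mat n n" and s: "s \<in> carrier_mat n n" and z: "z \<in> carrier_mat n n"
    and unitary: "spin_u1 n u * mat_adjoint (spin_u1 n u) = 1\<^sub>m (n * n)"
    and intertwines: "kron s (1\<^sub>m n) * spin_u1 n u = spin_u1 n u * kron z (1\<^sub>m n)"
  shows "kron s (1\<^sub>m n) \<in> spin_algebra n u 1"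
proof -
  let ?v = "spin_u1 n u"
  have v: "?v \<in> carrier_mat (n * n) (n * n)"
    by (rule spin_u1_carrier[OF u])
  have S: "kron s (1\<^sub>m n) \<in> carrier_mat (n * n) (n * n)"
    using s by auto
  have U: "spin_unitary n u 1 = ?v"
  proof -
    have "kron (kron (1\<^sub>m 1) ?v) (1\<^sub>m 1) = ?v"
      by (rule eq_matI) (auto simp: index_kron)
    then show ?thesis
      using v by (simp add: spin_unitary_def)
  qed
  have "kron s (1\<^sub>m n) = kron s (1\<^sub>m n) * (?v * mat_adjoint ?v)"
    unfolding unitary right_mult_one_mat[OF S] ..
  also have "\<dots> = ?v * kron z (1\<^sub>m n) * mat_adjoint ?v"
    unfolding assoc_mult_mat[OF S v mat_adjoint_carrier[OF v], symmetric] intertwines ..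
  finally show ?thesis
    using z unfolding spin_algebra_def U by auto
qed

lemma index_spin_D:
  assumes "r < n * n" and "s < n * n"
  shows "spin_D n u $$ (r, s) = (if r = s then sqrt (real n) * cnj (u $$ (r mod n, r div n)) else 0)"
proof -
  have n: "r div n < n" "s div n < n" "r mod n < n" "s mod n < n"
    using assms less_mult_imp_div_less mod_less_of_less_mult by blast+
  have eq: "r = s \<longleftrightarrow> s div n = r div n \<and> s mod n = r mod n"
    by (metis div_mult_mod_eq)
  have "(\<Sum>i<n. \<Sum>j<n. cnj (u $$ (i, j)) * kron (unit_mat n j j) (unit_mat n i i) $$ (r, s))
    = (\<Sum>i<n. \<Sum>j<n. if j = r div n then
      if i = r mod n then if r = s then cnj (u $$ (i, j)) else 0 else 0 else 0)"
    using assms n by (intro sum.cong refl) (auto simp: index_kron unit_mat_def eq)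
  also have "\<dots> = (if r = s then cnj (u $$ (r mod n, r div n)) else 0)"
    using n by simp
  finally show ?thesis
    using assms by (simp add: spin_D_def)
qed

text \<open>
  \<open>D\<^sub>u\<close> is diagonal, so \<open>u\<^sub>1\<close> arises from \<open>u \<otimes> I\<close> by rescaling its columns.
\<close>

lemma index_spin_u1:
  assumes u: "u \<in> carrier_mat n n" and r: "r < n * n" and s: "s < n * n"
  shows "spin_u1 n u $$ (r, s) = (if r mod n = s mod n
    then sqrt (real n) * u $$ (r div n, s div n) * cnj (u $$ (s mod n, s div n)) else 0)"
proof -
  have n: "r div n < n" "s div n < n" "r mod n < n" "s mod n < n"
    using r s less_mult_imp_div_less mod_less_of_less_mult by blast+
  have "spin_u1 n u $$ (r, s) = (\<Sum>m<n * n. kron u (1\<^sub>m n) $$ (r, m) * spin_D n u $$ (m, s))"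
    using u r s by (simp add: spin_u1_def scalar_prod_def spin_D_def atLeast0LessThan)
  also have "\<dots> = (\<Sum>m<n * n. if m = s
    then kron u (1\<^sub>m n) $$ (r, s) * (sqrt (real n) * cnj (u $$ (s mod n, s div n))) else 0)"
    using s by (intro sum.cong refl) (auto simp: index_spin_D)
  also have "\<dots> = kron u (1\<^sub>m n) $$ (r, s) * (sqrt (real n) * cnj (u $$ (s mod n, s div n)))"
    using s by simp
  finally show ?thesis
    using u r s n by (simp add: index_kron)
qed


section \<open>The Hadamard unitaries of order two\<close>

definition mat2 :: "complex \<Rightarrow> complex \<Rightarrow> complex \<Rightarrow> complex \<Rightarrow> complex mat"
  where "mat2 a b c d = mat_of_rows_list 2 [[a, b], [c, d]]"

lemma carrier_mats2 [simp]: "hadamard2 \<alpha> \<in> carrier_mat 2 2" "mat2 a b c d \<in> carrier_mat 2 2"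
  by (auto simp: hadamard2_def mat2_def mat_of_rows_list_def)

lemma less_4_cases: "(i::nat) < 4 \<Longrightarrow> i = 0 \<or> i = 1 \<or> i = 2 \<or> i = 3"
  by auto

lemma sum_lessThan_4: "sum f {0..<4::nat} = f 0 + f 1 + f 2 + (f 3 :: complex)"
  by (simp add: numeral_eq_Suc)

lemma index_hadamard2 [simp]:
  "hadamard2 \<alpha> $$ (0, 0) = 1 / sqrt 2" "hadamard2 \<alpha> $$ (0, Suc 0) = 1 / sqrt 2"
  "hadamard2 \<alpha> $$ (Suc 0, 0) = cis \<alpha> / sqrt 2" "hadamard2 \<alpha> $$ (Suc 0, Suc 0) = - (cis \<alpha> / sqrt 2)"
  by (simp_all add: hadamard2_def mat_of_rows_list_def cis_conv_exp)

lemma index_mat2 [simp]: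
  "mat2 a b c d $$ (0, 0) = a" "mat2 a b c d $$ (0, Suc 0) = b"
  "mat2 a b c d $$ (Suc 0, 0) = c" "mat2 a b c d $$ (Suc 0, Suc 0) = d"
  "dim_row (mat2 a b c d) = 2" "dim_col (mat2 a b c d) = 2"
  by (simp_all add: mat2_def mat_of_rows_list_def)

lemma spin_u1_hadamard2:
  "spin_u1 2 (hadamard2 \<alpha>) = mat_of_rows_list 4
    (map (map (\<lambda>z. z / sqrt 2)) [[1, 0, 1, 0], [0, cis (- \<alpha>), 0, - cis (- \<alpha>)],
     [cis \<alpha>, 0, - cis \<alpha>, 0], [0, 1, 0, 1]])" (is "_ = ?R")
proof (rule eq_matI)
  have sqrt2: "complex_of_real (sqrt 2) * complex_of_real (sqrt 2) = 2"
    by (simp flip: of_real_mult)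
  fix i j
  assume "i < dim_row ?R" "j < dim_col ?R"
  then have "i < 4" "j < 4"
    by (simp_all add: mat_of_rows_list_def)
  note ij = less_4_cases[OF this(1)] less_4_cases[OF this(2)]
  show "spin_u1 2 (hadamard2 \<alpha>) $$ (i, j) = ?R $$ (i, j)"
    using ij
    by (elim disjE; hypsubst)
     (simp_all add: index_spin_u1 mat_of_rows_list_def cis_cnj cis_mult sqrt2)
qed (simp_all add: mat_of_rows_list_def carrier_matD[OF spin_u1_carrier[OF carrier_mats2(1)]])


lemma spin_u1_unitary:
  "mat_adjoint (spin_u1 2 (hadamard2 \<alpha>)) * spin_u1 2 (hadamard2 \<alpha>) = 1\<^sub>m (2 * 2)" (is "?L = ?R")
  "spin_u1 2 (hadamard2 \<alpha>) * mat_adjoint (spin_u1 2 (hadamard2 \<alpha>)) = 1\<^sub>m (2 * 2)" (is "?L' = ?R")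
proof -
  have sqrt2: "complex_of_real (sqrt 2) * complex_of_real (sqrt 2) = 2"
    by (simp flip: of_real_mult)
  note simps = spin_u1_hadamard2 mat_of_rows_list_def scalar_prod_def sum_lessThan_4 cis_cnj cis_mult sqrt2
  have entry: "?L $$ (i, j) = ?R $$ (i, j)" "?L' $$ (i, j) = ?R $$ (i, j)" if "i < 4" "j < 4" for i j
    using less_4_cases[OF that(1)] less_4_cases[OF that(2)]
    by (elim disjE; hypsubst; simp add: simps)+
  note dims = carrier_matD[OF spin_u1_carrier[OF carrier_mats2(1)]]
  show "?L = ?R"
    by (intro eq_matI entry(1)) (simp_all add: dims)
  show "?L' = ?R"
    by (intro eq_matI entry(2)) (simp_all add: dims)
qed

text \<open>
  Write \<open>X\<close>, \<open>Z\<close> for the Pauli matrices and \<open>s\<close> for the reflection with entries \<open>cis (\<plusminus> \<alpha>)\<close>.  The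
  Hadamard unitary \<open>H\<close> satisfies \<open>s H = H Z\<close> and \<open>Z H = H X\<close>, while \<open>D\<^sub>H\<close> is, up to a phase that depends only
  on the second factor, the controlled sign flip, which commutes with \<open>Z \<otimes> I\<close> and turns \<open>X \<otimes> I\<close> into
  \<open>X \<otimes> Z\<close>.  So \<open>u\<^sub>1\<close> intertwines \<open>s\<close> with \<open>Z \<otimes> I\<close>, \<open>Z\<close> with \<open>X \<otimes> Z\<close>, and the product
  \<open>Z s\<close> with \<open>X Z \<otimes> Z\<close>.
\<close>

lemma spin_u1_intertwines:
  "kron (mat2 0 (cis (- \<alpha>)) (cis \<alpha>) 0) (1\<^sub>m 2) * spin_u1 2 (hadamard2 \<alpha>) =
    spin_u1 2 (hadamard2 \<alpha>) * kron (mat2 1 0 0 (-1)) (1\<^sub>m 2)" (is "?L1 = ?R1")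
  "kron (mat2 1 0 0 (-1)) (1\<^sub>m 2) * spin_u1 2 (hadamard2 \<alpha>) =
    spin_u1 2 (hadamard2 \<alpha>) * kron (mat2 0 1 1 0) (mat2 1 0 0 (-1))" (is "?L2 = ?R2")
  "kron (mat2 0 (cis (- \<alpha>)) (- cis \<alpha>) 0) (1\<^sub>m 2) * spin_u1 2 (hadamard2 \<alpha>) =
    spin_u1 2 (hadamard2 \<alpha>) * kron (mat2 0 (-1) 1 0) (mat2 1 0 0 (-1))" (is "?L3 = ?R3")
proof -
  note simps = spin_u1_hadamard2 mat_of_rows_list_def scalar_prod_def sum_lessThan_4 index_kron cis_mult
  have entry: "?L1 $$ (i, j) = ?R1 $$ (i, j)" "?L2 $$ (i, j) = ?R2 $$ (i, j)" "?L3 $$ (i, j) = ?R3 $$ (i, j)"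
    if "i < 4" "j < 4" for i j
    using less_4_cases[OF that(1)] less_4_cases[OF that(2)]
    by (elim disjE; hypsubst; simp add: simps)+
  show "?L1 = ?R1" "?L2 = ?R2" "?L3 = ?R3"
    using spin_u1_carrier[OF carrier_mats2(1)[of \<alpha>]] by (auto intro!: eq_matI entry)
qed

lemma mat_eq2I:
  fixes A B :: "complex mat"
  assumes "A \<in> carrier_mat 2 2" and "B \<in> carrier_mat 2 2"
    and "A $$ (0, 0) = B $$ (0, 0)" and "A $$ (0, Suc 0) = B $$ (0, Suc 0)"
    and "A $$ (Suc 0, 0) = B $$ (Suc 0, 0)" and "A $$ (Suc 0, Suc 0) = B $$ (Suc 0, Suc 0)"
  shows "A = B"
  using assms by (intro eq_matI) (auto simp: less_2_cases_iff)

lemma mat_adjoint_mat2: "mat_adjoint (mat2 a b c d) = mat2 (cnj a) (cnj c) (cnj b) (cnj d)"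
  by (rule mat_eq2I) (simp_all add: mat_adjoint_carrier)

lemma reflection_unitary:
  "mat_adjoint (mat2 0 (cis (- \<alpha>)) (cis \<alpha>) 0) * mat2 0 (cis (- \<alpha>)) (cis \<alpha>) 0 = 1\<^sub>m 2"
  by (rule mat_eq2I[OF mult_carrier_mat[OF mat_adjoint_carrier[OF carrier_mats2(2)] carrier_mats2(2)] one_carrier_mat])
    (simp_all add: mat_adjoint_mat2 scalar_prod_def numeral_2_eq_2 cis_cnj cis_mult)

text \<open>
  The two matrices on the right are \<open>- Z s\<^sub>\<alpha>\<close> and \<open>- Z s\<^sub>\<beta>\<close>.  The determinant of their off-diagonal
  entries is \<open>cis (\<alpha> - \<beta>) - cis (\<beta> - \<alpha>) = 2 \<i> sin (\<alpha> - \<beta>)\<close>, so they are linearly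
  independent for parameters distinct modulo \<open>\<pi>\<close>; the coefficients come from Cramer's rule.
\<close>

lemma reflection_in_span:
  assumes "\<bar>\<alpha> - \<beta>\<bar> < pi" and "\<alpha> \<noteq> \<beta>"
  obtains c d where "mat2 0 (cis (- \<alpha>)) (cis \<alpha>) 0 =
    c \<cdot>\<^sub>m mat2 0 (- cis (- \<alpha>)) (cis \<alpha>) 0 + d \<cdot>\<^sub>m mat2 0 (- cis (- \<beta>)) (cis \<beta>) 0"
proof -
  define D where "D = cis (\<beta> - \<alpha>) - cis (\<alpha> - \<beta>)"
  have "sin (\<alpha> - \<beta>) \<noteq> 0"
    using assms sin_eq_0_pi[of "\<alpha> - \<beta>"] by (auto simp: abs_less_iff)
  then have "D \<noteq> 0"
    using sin_minus[of "\<alpha> - \<beta>"] by (auto simp: D_def complex_eq_iff)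
  define d where "d = 2 / D"
  define c where "c = 1 - d * cis (\<beta> - \<alpha>)"
  have dD: "d * cis (\<beta> - \<alpha>) - d * cis (\<alpha> - \<beta>) = 2"
  proof -
    have "d * D = 2"
      using \<open>D \<noteq> 0\<close> by (simp add: d_def)
    then show ?thesis
      by (simp add: D_def right_diff_distrib)
  qed
  have split: "cis (- \<beta>) = cis (\<alpha> - \<beta>) * cis (- \<alpha>)" "cis \<beta> = cis (\<beta> - \<alpha>) * cis \<alpha>"
    by (simp_all add: cis_mult)
  have upper: "c * (- cis (- \<alpha>)) + d * (- cis (- \<beta>)) = cis (- \<alpha>)"
  proof -
    have "c * (- cis (- \<alpha>)) + d * (- cis (- \<beta>))
      = (d * cis (\<beta> - \<alpha>) - d * cis (\<alpha> - \<beta>) - 1) * cis (- \<alpha>)"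
      unfolding split c_def by (simp add: algebra_simps)
    then show ?thesis
      by (simp add: dD)
  qed
  have lower: "c * cis \<alpha> + d * cis \<beta> = cis \<alpha>"
    unfolding split c_def by (simp add: algebra_simps)
  show ?thesis
    by (rule that[of c d], rule mat_eq2I) (use upper lower in simp_all)
qed


section \<open>Operators on a Hilbert space\<close>

lemma cinner_diff_right: "cinner x (y - z) = cinner x y - cinner x (z :: 'h :: chilbert_space)"
  by (metis add_diff_cancel cinner_add_right diff_add_cancel)

lemma cinner_diff_left: "cinner (x - y) z = cinner x z - cinner y (z :: 'h :: chilbert_space)"
  by (metis cinner_commute cinner_diff_right complex_cnj_diff)

lemma cinner_add_left: "cinner (x + y) z = cinner x z + cinner y (z :: 'h :: chilbert_space)"
  by (metis cinner_commute cinner_add_right complex_cnj_add)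

lemma norm_eq_cinner: "complex_of_real ((norm x)\<^sup>2) = cinner x (x :: 'h :: chilbert_space)"
proof -
  have "Im (cinner x x) = 0"
    using arg_cong[OF cinner_commute[of x x], of Im] by simp
  then show ?thesis
    by (simp add: complex_eq_iff norm_eq_sqrt_cinner cinner_self_ge_zero)
qed

lemma is_adjoint_op_commute:
  "is_adjoint_op S T \<Longrightarrow> cinner (T x) y = cinner x (S y)"
  unfolding is_adjoint_op_def by (metis cinner_commute)

lemma subset_weak_closure: "S \<subseteq> weak_closure S"
  unfolding weak_closure_def weak_operator_topology_def
  by (rule closure_of_subset) (simp add: topspace_pullback_topology)

text \<open>
  Matrix coefficients are continuous in the weak operator topology, so a linear condition on one of
  them passes to weak limits.  Orthogonality relations therefore need to be checked only
  for the matrices that generate a subfactor.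
\<close>

lemma weak_closure_orthogonal:
  assumes T: "T \<in> weak_closure S" and S: "\<And>y. y \<in> S \<Longrightarrow> cinner v (blinfun_apply y w) = 0"
  shows "cinner v (blinfun_apply T w) = 0"
proof -
  have "continuous_on UNIV (\<lambda>h :: 'a \<Rightarrow> 'a \<Rightarrow> complex. h v w)"
    using continuous_on_product_coordinates by (rule continuous_on_product_then_coordinatewise)
  then have "continuous_map weak_operator_topology euclidean
      ((\<lambda>h. h v w) \<circ> (\<lambda>T x y. cinner x (blinfun_apply T y)))"
    unfolding weak_operator_topology_def by (intro continuous_map_pullback) simp
  then have "closedin weak_operator_topology
      {y \<in> topspace weak_operator_topology. ((\<lambda>h. h v w) \<circ> (\<lambda>T x y. cinner x (blinfun_apply T y))) y \<in> {0}}"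
    by (rule closedin_continuous_map_preimage) simp
  moreover have "topspace weak_operator_topology = (UNIV :: ('a \<Rightarrow>\<^sub>L 'a) set)"
    by (simp add: weak_operator_topology_def topspace_pullback_topology)
  ultimately have "closedin weak_operator_topology {y. cinner v (blinfun_apply y w) = 0}"
    by simp
  then have "weak_operator_topology closure_of S \<subseteq> {y. cinner v (blinfun_apply y w) = 0}"
    using S by (intro closure_of_minimal) auto
  then show ?thesis
    using T by (auto simp: weak_closure_def)
qed

text \<open>
  The operator norm dominates \<open>T \<mapsto> \<parallel>T \<Omega>\<parallel>\<close>, in which the distance of \<open>s\<close> to anything orthogonal is at
  least \<open>\<parallel>s \<Omega>\<parallel> = 1\<close>.  Only one of the two suprema needs a witness, because neither can
  exceed 1.
\<close>

lemma kadison_kastler_dist_eq_1: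
  fixes P Q :: "('h :: chilbert_space \<Rightarrow>\<^sub>L 'h) set" and \<Omega> :: 'h
  assumes zero: "0 \<in> P" "0 \<in> Q"
    and \<Omega>: "norm \<Omega> = 1"
    and s: "s \<in> P" "norm s \<le> 1" "norm (s \<Omega>) = 1"
    and orthogonal: "\<And>y. y \<in> Q \<Longrightarrow> cinner (y \<Omega>) (s \<Omega>) = 0"
  shows "kadison_kastler_dist P Q = 1"
proof -
  have le: "infdist x (B \<inter> cball 0 1) \<le> 1" if "x \<in> A \<inter> cball 0 1" "0 \<in> B"
    for x :: "'h \<Rightarrow>\<^sub>L 'h" and A B
    using that infdist_le2[of 0 "B \<inter> cball 0 1" x 1] by (auto simp: dist_norm)
  have bdd: "bdd_above ((\<lambda>x. infdist x (B \<inter> cball 0 1)) ` (A \<inter> cball 0 1))" if "0 \<in> B"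
    for A B :: "('h \<Rightarrow>\<^sub>L 'h) set"
    using le that by (intro bdd_aboveI2[where M = 1]) blast
  have "1 \<le> dist s y" if "y \<in> Q" for y
  proof -
    have "cinner (s \<Omega>) (y \<Omega>) = 0"
      using orthogonal[OF that] by (metis cinner_commute complex_cnj_zero)
    then have "cinner (s \<Omega> - y \<Omega>) (s \<Omega> - y \<Omega>) = cinner (s \<Omega>) (s \<Omega>) + cinner (y \<Omega>) (y \<Omega>)"
      using orthogonal[OF that] by (simp add: cinner_diff_left cinner_diff_right)
    then have "(norm (s \<Omega> - y \<Omega>))\<^sup>2 = (norm (s \<Omega>))\<^sup>2 + (norm (y \<Omega>))\<^sup>2"
      unfolding norm_eq_cinner[symmetric] by (metis of_real_add of_real_eq_iff)
    then have "1\<^sup>2 \<le> (norm (s \<Omega> - y \<Omega>))\<^sup>2"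
      using s(3) by simp
    then have "1 \<le> norm (s \<Omega> - y \<Omega>)"
      by (rule power2_le_imp_le) simp
    also have "s \<Omega> - y \<Omega> = (s - y) \<Omega>"
      by (simp add: blinfun.diff_left)
    also have "norm \<dots> \<le> norm (s - y)"
      using norm_blinfun[of "s - y" \<Omega>] \<Omega> by simp
    finally show ?thesis
      by (simp add: dist_norm)
  qed
  then have "1 \<le> infdist s (Q \<inter> cball 0 1)"
    using zero(2) by (auto simp: infdist_def intro!: cINF_greatest)
  also have "\<dots> \<le> (SUP x\<in>P \<inter> cball 0 1. infdist x (Q \<inter> cball 0 1))"
    using s zero bdd by (intro cSUP_upper) auto
  finally have "1 \<le> (SUP x\<in>P \<inter> cball 0 1. infdist x (Q \<inter> cball 0 1))" .
  moreover have sup_le: "(SUP x\<in>A \<inter> cball 0 1. infdist x (B \<inter> cball 0 1)) \<le> 1" if "0 \<in> A" "0 \<in> B"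
    for A B :: "('h \<Rightarrow>\<^sub>L 'h) set"
  proof (rule cSUP_least)
    show "A \<inter> cball 0 1 \<noteq> {}"
      using that(1) by auto
  qed (use le that(2) in blast)
  ultimately have "(SUP x\<in>P \<inter> cball 0 1. infdist x (Q \<inter> cball 0 1)) = 1"
    using zero by (intro antisym) auto
  then show ?thesis
    using sup_le[OF zero(2,1)] by (simp add: kadison_kastler_dist_def hausdorff_dist_def max_absorb1)
qed

text \<open>
  The module property and trace invariance of the expectation on \<open>Q\<close> give
  \<open>\<langle>y \<Omega>, s \<Omega>\<rangle> = \<langle>y \<Omega>, e \<Omega>\<rangle>\<close> for \<open>y\<close> in \<open>Q\<close>, where \<open>e\<close> is the expectation of \<open>s\<close> on \<open>Q\<close>.  The commuting
  square places \<open>e\<close> in \<open>N\<close>; taking \<open>y = e\<close> then yields \<open>\<parallel>e \<Omega>\<parallel>\<^sup>2 = \<langle>e \<Omega>, s \<Omega>\<rangle> = 0\<close>.  Describing \<open>Q\<close> as the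
  closure of \<open>S\<close> confines the use of adjoints to \<open>S\<close>, where they are explicit matrices.
\<close>

lemma commuting_square_orthogonal:
  fixes \<Omega> :: "'h :: chilbert_space"
  assumes square: "commuting_square (vector_state \<Omega>) M N P (weak_closure S)"
    and s: "s \<in> P"
    and id: "id_blinfun \<in> weak_closure S"
    and adjoint: "\<And>y. y \<in> S \<Longrightarrow> \<exists>y'\<in>S. is_adjoint_op y' y \<and> y' o\<^sub>L s \<in> M"
    and N_orthogonal: "\<And>e. e \<in> N \<Longrightarrow> cinner (s \<Omega>) (e \<Omega>) = 0"
    and y: "y \<in> weak_closure S"
  shows "cinner (y \<Omega>) (s \<Omega>) = 0"
proof -
  let ?Q = "weak_closure S"
  from square obtain E\<^sub>N E\<^sub>P E\<^sub>Q where N: "N \<subseteq> ?Q" and P: "P \<subseteq> M"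
    and E\<^sub>N: "cond_expectation (vector_state \<Omega>) M N E\<^sub>N"
    and E\<^sub>P: "cond_expectation (vector_state \<Omega>) M P E\<^sub>P"
    and E\<^sub>Q: "cond_expectation (vector_state \<Omega>) M ?Q E\<^sub>Q"
    and commute: "\<And>x. x \<in> M \<Longrightarrow> E\<^sub>Q (E\<^sub>P x) = E\<^sub>N x"
    unfolding commuting_square_def by auto
  define e where "e = E\<^sub>N s"
  have sM: "s \<in> M"
    using s P by auto
  have e: "e \<in> N"
    using E\<^sub>N sM unfolding cond_expectation_def e_def by blast
  have "E\<^sub>P s = s"
    using E\<^sub>P s unfolding cond_expectation_def by blast
  then have E\<^sub>Qs: "E\<^sub>Q s = e"
    using commute[OF sM] by (simp add: e_def)
  have "cinner (s \<Omega> - e \<Omega>) (z \<Omega>) = 0" if z: "z \<in> ?Q" for z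
    using z
  proof (rule weak_closure_orthogonal)
    fix y assume "y \<in> S"
    then obtain y' where y': "y' \<in> S" "is_adjoint_op y' y" "y' o\<^sub>L s \<in> M"
      using adjoint by blast
    have y'Q: "y' \<in> ?Q"
      using y'(1) subset_weak_closure by blast
    have "E\<^sub>Q (y' o\<^sub>L s o\<^sub>L id_blinfun) = y' o\<^sub>L e o\<^sub>L id_blinfun"
      using E\<^sub>Q y'Q id sM E\<^sub>Qs unfolding cond_expectation_def by metis
    moreover have "vector_state \<Omega> (E\<^sub>Q (y' o\<^sub>L s)) = vector_state \<Omega> (y' o\<^sub>L s)"
      using E\<^sub>Q y'(3) unfolding cond_expectation_def by blast
    moreover have "x o\<^sub>L id_blinfun = x" for x :: "'h \<Rightarrow>\<^sub>L 'h"
      by (rule blinfun_eqI) simp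
    ultimately have "vector_state \<Omega> (y' o\<^sub>L e) = vector_state \<Omega> (y' o\<^sub>L s)"
      by simp
    then have "cinner (y \<Omega>) (s \<Omega> - e \<Omega>) = 0"
      by (simp add: vector_state_def is_adjoint_op_commute[OF y'(2)] cinner_diff_right)
    then show "cinner (s \<Omega> - e \<Omega>) (y \<Omega>) = 0"
      by (metis cinner_commute complex_cnj_zero)
  qed
  note orthogonal = this
  have "cinner (e \<Omega>) (e \<Omega>) = 0"
    using orthogonal[of e] N_orthogonal[OF e] e N by (auto simp: cinner_diff_left)
  then have "norm (e \<Omega>) = 0"
    using norm_eq_cinner[of "e \<Omega>"] by simp
  then have "cinner (s \<Omega>) (y \<Omega>) = 0"
    using orthogonal[OF y] by simp
  then show ?thesis
    by (metis cinner_commute complex_cnj_zero)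
qed

context gns_representation
begin

lemma norm_\<Omega>: "norm \<Omega> = 1"
proof -
  have "vector_state \<Omega> (\<pi> (1\<^sub>m (n ^ 0))) = 1"
    by (subst trace[where k = 0]) auto
  then have "cinner \<Omega> \<Omega> = 1"
    using one[of 0] by (simp add: vector_state_def)
  then show ?thesis
    by (simp add: norm_eq_sqrt_cinner)
qed

lemma embedding_power: "x \<in> tensor_power_mats n k \<Longrightarrow> \<pi> (kron x (1\<^sub>m (n ^ j))) = \<pi> x"
proof (induction j)
  case 0
  have "kron x (1\<^sub>m 1) = x"
    by (rule eq_matI) (auto simp: index_kron)
  then show ?case by simp
next
  case (Suc j)
  have "kron x (1\<^sub>m (n ^ Suc j)) = kron (kron x (1\<^sub>m (n ^ j))) (1\<^sub>m n)"
    by (simp add: kron_assoc kron_one mult.commute)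
  moreover have "kron x (1\<^sub>m (n ^ j)) \<in> tensor_power_mats n (k + j)"
    using Suc.prems by (auto simp: power_add)
  ultimately show ?case
    using Suc embedding by metis
qed

lemma cinner_representation:
  assumes x: "x \<in> tensor_power_mats n k" and y: "y \<in> tensor_power_mats n k"
  shows "cinner (\<pi> (mat_adjoint x) \<Omega>) (\<pi> y \<Omega>) = mat_trace (x * y) / of_nat (n ^ k)"
proof -
  have "cinner (\<pi> (mat_adjoint x) \<Omega>) (\<pi> y \<Omega>) = vector_state \<Omega> (\<pi> (x * y))"
    using adjoint[OF x] by (simp add: is_adjoint_op_def vector_state_def mult[OF x y])
  then show ?thesis
    using trace[OF mult_carrier_mat[OF x y]] x y by (simp add: mat_trace_def)
qed

text \<open>
  The vector state of \<open>\<Omega>\<close> is the trace on matrices, so the hypothesis states the orthogonality at each finite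
  level, \<open>x\<close> being embedded in as many tensor factors as \<open>y\<close> occupies.
\<close>

lemma spin_subfactor_orthogonal:
  assumes u: "u \<in> carrier_mat n n" and x: "x \<in> carrier_mat n n"
    and trace_zero: "\<And>k y. y \<in> spin_algebra n u (Suc k) \<Longrightarrow> mat_trace (kron x (1\<^sub>m (n ^ Suc k)) * y) = 0"
    and T: "T \<in> spin_subfactor n \<pi> u"
  shows "cinner (\<pi> (mat_adjoint x) \<Omega>) (T \<Omega>) = 0"
  using T unfolding spin_subfactor_def
proof (rule weak_closure_orthogonal)
  fix t assume "t \<in> (\<Union>k\<in>{1..}. \<pi> ` spin_algebra n u k)"
  then obtain k y where "1 \<le> k" and y: "y \<in> spin_algebra n u k" and t: "t = \<pi> y"
    by auto
  then obtain l where k: "k = Suc l"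
    by (cases k) auto
  have X: "kron x (1\<^sub>m (n ^ k)) \<in> tensor_power_mats n (k + 1)"
    using x by auto
  have "\<pi> (mat_adjoint x) = \<pi> (kron (mat_adjoint x) (1\<^sub>m (n ^ k)))"
    using embedding_power[of "mat_adjoint x" 1 k] mat_adjoint_carrier[OF x] by simp
  also have "kron (mat_adjoint x) (1\<^sub>m (n ^ k)) = mat_adjoint (kron x (1\<^sub>m (n ^ k)))"
    by (simp add: mat_adjoint_kron mat_adjoint_one)
  finally show "cinner (\<pi> (mat_adjoint x) \<Omega>) (t \<Omega>) = 0"
    using cinner_representation[OF X spin_algebra_carrier[OF u y]] trace_zero y t k by simp
qed

lemma spin_algebra_subset_subfactor:
  "y \<in> spin_algebra n u (Suc k) \<Longrightarrow> \<pi> y \<in> spin_subfactor n \<pi> u"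
  unfolding spin_subfactor_def by (rule subsetD[OF subset_weak_closure]) auto

lemma spin_algebra_adjoint:
  assumes u: "u \<in> carrier_mat n n" and x: "x \<in> carrier_mat n n"
    and t: "t \<in> (\<Union>k\<in>{1..}. \<pi> ` spin_algebra n u k)"
  shows "\<exists>t'\<in>(\<Union>k\<in>{1..}. \<pi> ` spin_algebra n u k).
    is_adjoint_op t' t \<and> t' o\<^sub>L \<pi> x \<in> hyperfinite_factor n \<pi>"
proof -
  obtain k y where k: "1 \<le> k" and y: "y \<in> spin_algebra n u k" and t: "t = \<pi> y"
    using t by auto
  have y': "mat_adjoint y \<in> spin_algebra n u k"
    by (rule mat_adjoint_spin_algebra[OF u y])
  have X: "kron x (1\<^sub>m (n ^ k)) \<in> tensor_power_mats n (k + 1)"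
    using x by auto
  have "\<pi> (mat_adjoint y) o\<^sub>L \<pi> x = \<pi> (mat_adjoint y * kron x (1\<^sub>m (n ^ k)))"
    using embedding_power[of x 1 k] x mult[OF spin_algebra_carrier[OF u y'] X] by simp
  then have "\<pi> (mat_adjoint y) o\<^sub>L \<pi> x \<in> hyperfinite_factor n \<pi>"
    unfolding hyperfinite_factor_def
    using mult_carrier_mat[OF spin_algebra_carrier[OF u y'] X]
    by (intro subsetD[OF subset_weak_closure]) blast
  then show ?thesis
    using k y' t adjoint[OF spin_algebra_carrier[OF u y]] by blast
qed

lemma norm_representation_isometry:
  assumes x: "x \<in> tensor_power_mats n k" and unitary: "mat_adjoint x * x = 1\<^sub>m (n ^ k)"
  shows "norm (\<pi> x v) = norm v"
proof -
  have "\<pi> (mat_adjoint x) o\<^sub>L \<pi> x = id_blinfun"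
    using mult[OF mat_adjoint_carrier[OF x] x] one unitary by simp
  then have "\<pi> (mat_adjoint x) (\<pi> x v) = v"
    by (metis blinfun_apply_blinfun_compose id_blinfun.rep_eq id_apply)
  then have "cinner (\<pi> x v) (\<pi> x v) = cinner v v"
    by (metis is_adjoint_op_commute[OF adjoint[OF x]])
  then show ?thesis
    by (simp add: norm_eq_sqrt_cinner)
qed

lemma spin_subfactorI:
  assumes u: "u \<in> carrier_mat n n" and s: "s \<in> carrier_mat n n" and z: "z \<in> carrier_mat n n"
    and unitary: "spin_u1 n u * mat_adjoint (spin_u1 n u) = 1\<^sub>m (n * n)"
    and intertwines: "kron s (1\<^sub>m n) * spin_u1 n u = spin_u1 n u * kron z (1\<^sub>m n)"
  shows "\<pi> s \<in> spin_subfactor n \<pi> u"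
proof -
  have "\<pi> (kron s (1\<^sub>m n)) \<in> spin_subfactor n \<pi> u"
    using spin_algebra_subset_subfactor[of _ u 0] spin_algebra_oneI[OF assms] by simp
  then show ?thesis
    using embedding[of s 1] s by simp
qed

lemma representation_zero: "\<pi> (0\<^sub>m n n) = 0"
  using add[of "0\<^sub>m n n" 1 "0\<^sub>m n n"] by simp

end


section \<open>Distance between the subfactors\<close>

text \<open>
  The matrix is \<open>(Z s\<^sub>\<alpha>)\<^sup>*\<close>; under \<open>u\<^bsub>2k-1\<^esub>\<close> its adjoint moves to the right and ends in the traceless \<open>Z\<close>.
\<close>

lemma hadamard2_subfactor_orthogonal:
  assumes "gns_representation 2 \<pi> \<Omega>" and "T \<in> spin_subfactor 2 \<pi> (hadamard2 \<alpha>)"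
  shows "cinner (\<pi> (mat2 0 (- cis (- \<alpha>)) (cis \<alpha>) 0) \<Omega>) (T \<Omega>) = 0"
proof -
  interpret gns_representation 2 \<pi> \<Omega>
    by (rule assms(1))
  have sign_trace: "mat_trace (mat2 1 0 0 (-1)) = 0"
    by (simp add: mat_trace_def numeral_2_eq_2)
  have "cinner (\<pi> (mat_adjoint (mat2 0 (cis (- \<alpha>)) (- cis \<alpha>) 0)) \<Omega>) (T \<Omega>) = 0"
    using assms(2)
    by (intro spin_subfactor_orthogonal[OF carrier_mats2]
        spin_algebra_trace_zero[OF carrier_mats2(1) carrier_mats2(2) carrier_mats2(2) carrier_mats2(2) carrier_mats2(2)
          spin_u1_unitary(1) spin_u1_intertwines(3) spin_u1_intertwines(2) sign_trace])
  then show ?thesis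
    by (simp add: mat_adjoint_mat2 cis_cnj)
qed

theorem corollary3p21:
  fixes \<pi> :: "complex mat \<Rightarrow> ('h :: chilbert_space \<Rightarrow>\<^sub>L 'h)"
    and \<Omega> :: 'h
    and \<alpha> \<beta> :: real
  assumes "gns_representation 2 \<pi> \<Omega>"
    and "0 \<le> \<alpha>" and "\<alpha> < pi" and "0 \<le> \<beta>" and "\<beta> < pi" and "\<alpha> \<noteq> \<beta>"
    and "commuting_square (vector_state \<Omega>) (hyperfinite_factor 2 \<pi>)
      (spin_subfactor 2 \<pi> (hadamard2 \<alpha>) \<inter> spin_subfactor 2 \<pi> (hadamard2 \<beta>))
      (spin_subfactor 2 \<pi> (hadamard2 \<alpha>)) (spin_subfactor 2 \<pi> (hadamard2 \<beta>))"
  shows "kadison_kastler_dist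
      (spin_subfactor 2 \<pi> (hadamard2 \<alpha>)) (spin_subfactor 2 \<pi> (hadamard2 \<beta>)) = 1"
proof -
  interpret gns_representation 2 \<pi> \<Omega>
    by (rule assms(1))
  let ?R = "\<lambda>\<gamma>. spin_subfactor 2 \<pi> (hadamard2 \<gamma>)"
  let ?x = "\<lambda>\<gamma>. mat2 0 (- cis (- \<gamma>)) (cis \<gamma>) 0"
  define s where "s = mat2 0 (cis (- \<alpha>)) (cis \<alpha>) 0"
  have s: "s \<in> carrier_mat 2 2"
    by (simp add: s_def)
  have s_in: "\<pi> s \<in> ?R \<alpha>"
    unfolding s_def
    by (rule spin_subfactorI[OF carrier_mats2(1) carrier_mats2(2) carrier_mats2(2) spin_u1_unitary(2) spin_u1_intertwines(1)])
  have id_in: "id_blinfun \<in> ?R \<beta>"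
  proof -
    have "\<pi> (1\<^sub>m 2) \<in> ?R \<beta>"
      using spin_u1_carrier[OF carrier_mats2(1), of \<beta>]
      by (intro spin_subfactorI[OF carrier_mats2(1) _ _ spin_u1_unitary(2), of _ "1\<^sub>m 2"]) (auto simp: kron_one)
    then show ?thesis
      using one[of 1] by simp
  qed
  have zero_in: "0 \<in> ?R \<gamma>" for \<gamma>
  proof -
    have zero: "kron (0\<^sub>m 2 2) (1\<^sub>m 2) = 0\<^sub>m (2 * 2) (2 * 2)"
      by (rule eq_matI) (auto simp: index_kron less_mult_imp_div_less)
    have "\<pi> (0\<^sub>m 2 2) \<in> ?R \<gamma>"
      using spin_u1_carrier[OF carrier_mats2(1), of \<gamma>]
      by (intro spin_subfactorI[OF carrier_mats2(1) _ _ spin_u1_unitary(2), of _ "0\<^sub>m 2 2"]) (auto simp: zero)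
    then show ?thesis
      by (simp add: representation_zero)
  qed
  have norm_s: "norm (\<pi> s v) = norm v" for v
    using reflection_unitary[of \<alpha>] s by (intro norm_representation_isometry[where k = 1]) (simp_all add: s_def)
  obtain c d where s_span: "s = c \<cdot>\<^sub>m ?x \<alpha> + d \<cdot>\<^sub>m ?x \<beta>"
  proof -
    have "\<bar>\<alpha> - \<beta>\<bar> < pi"
      using assms(2-5) by (simp add: abs_less_iff)
    then show thesis
      using reflection_in_span[OF _ assms(6)] that unfolding s_def by blast
  qed
  have N_orthogonal: "cinner (\<pi> s \<Omega>) (e \<Omega>) = 0" if "e \<in> ?R \<alpha> \<inter> ?R \<beta>" for e
  proof -
    have "\<pi> s = scaleC_op c (\<pi> (?x \<alpha>)) + scaleC_op d (\<pi> (?x \<beta>))"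
      unfolding s_span using add[of "c \<cdot>\<^sub>m ?x \<alpha>" 1 "d \<cdot>\<^sub>m ?x \<beta>"] smult[of "?x \<alpha>" 1 c] smult[of "?x \<beta>" 1 d]
      by simp
    then show ?thesis
      using that hadamard2_subfactor_orthogonal[OF assms(1)]
      by (simp add: blinfun.add_left scaleC_op_apply cinner_add_left cinner_scaleC_left)
  qed
  have "cinner (y \<Omega>) (\<pi> s \<Omega>) = 0" if "y \<in> ?R \<beta>" for y
    using commuting_square_orthogonal[OF assms(7)[unfolded spin_subfactor_def[of _ _ "hadamard2 \<beta>"]]
        s_in id_in[unfolded spin_subfactor_def] spin_algebra_adjoint[OF carrier_mats2(1) s]]
      N_orthogonal that
    unfolding spin_subfactor_def[of _ _ "hadamard2 \<beta>"] by blast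
  moreover have "norm (\<pi> s) \<le> 1"
    by (rule norm_blinfun_bound) (simp_all add: norm_s)
  ultimately show ?thesis
    using zero_in s_in norm_\<Omega> norm_s by (intro kadison_kastler_dist_eq_1[of _ _ \<Omega> "\<pi> s"]) auto
qed

end
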